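(* Let $r$ be a positive integer and let $\mathcal{H}$ be a hereditary family with $\mu(\mathcal{H}) \geq n_{\rm S}(r,1)$. If $\mathcal{A}$ and $\mathcal{B}$ are cross-intersecting subfamilies of $\mathcal{H}^{(r)}$, then $|\mathcal{A}| + |\mathcal{B}| \leq |\mathcal{H}^{(r)}|$.
   Context: All sets and families are finite. A family $\mathcal{H}$ is hereditary if every subset of every member of $\mathcal{H}$ is a member of $\mathcal{H}$. A base of a family $\mathcal{F}$ is a set $B \in \mathcal{F}$ that is not a proper subset of any member of $\mathcal{F}$; $\mu(\mathcal{F})$ denotes the size of a smallest base of $\mathcal{F}$. $\mathcal{H}^{(r)} := \{H \in \mathcal{H} : |H| = r\}$. Families $\mathcal{A}$ and $\mathcal{B}$ are cross-intersecting if $A \cap B \neq \emptyset$ for every $A \in \mathcal{A}$ and $B \in \mathcal{B}$. Define $m(r,1) := \max\{2r, \frac{(r-1)(r+4)}{2}\}$ and $n_{\rm S}(r,1) := r\binom{m(r,1)}{2} + r$. *)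

theory Defs
  imports Complex_Main
begin

definition hereditary :: "'a set set \<Rightarrow> bool" where
  "hereditary H \<longleftrightarrow> (\<forall>X\<in>H. \<forall>Y. Y \<subseteq> X \<longrightarrow> Y \<in> H)"

definition is_base :: "'a set set \<Rightarrow> 'a set \<Rightarrow> bool" where
  "is_base F B \<longleftrightarrow> B \<in> F \<and> (\<forall>X\<in>F. \<not> B \<subset> X)"

text \<open>Every nonempty finite family has a base; for the empty family \<open>min_base_size\<close> is an
  unspecified number.\<close>

definition min_base_size :: "'a set set \<Rightarrow> nat" where
  "min_base_size F = Min {card B | B. is_base F B}"

definition level :: "'a set set \<Rightarrow> nat \<Rightarrow> 'a set set" where
  "level H r = {X \<in> H. card X = r}"

definition cross_intersecting :: "'a set set \<Rightarrow> 'a set set \<Rightarrow> bool" where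
  "cross_intersecting A B \<longleftrightarrow> (\<forall>X\<in>A. \<forall>Y\<in>B. X \<inter> Y \<noteq> {})"

text \<open>For \<open>r \<ge> 1\<close> the subtraction does not truncate, and the division is exact
  because \<open>r - 1\<close> and \<open>r + 4\<close> have opposite parity.\<close>

definition m_r1 :: "nat \<Rightarrow> nat" where
  "m_r1 r = max (2 * r) (((r - 1) * (r + 4)) div 2)"

definition n_S_r1 :: "nat \<Rightarrow> nat" where
  "n_S_r1 r = r * (m_r1 r choose 2) + r"

end

theory Submission
  imports Defs
begin

text \<open>If both families are nonempty, each lies in a union of \<open>r\<close> stars, namely those centred at the
  elements of a fixed member of the other family. Each star is small: when all bases have size at
  least \<open>n\<close>, exchanging the centre for another element of a base and double counting shows that a
  star contains at most a fraction \<open>r / n\<close> of the level. The value of \<open>n\<close> makes \<open>2 r\<close> stars fit.\<close>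

lemma ex_base_superset:
  assumes "finite H" "X \<in> H"
  obtains Y where "is_base H Y" "X \<subseteq> Y"
proof -
  obtain Y where "Y \<in> H" "X \<subseteq> Y" "\<And>Z. Z \<in> H \<Longrightarrow> Y \<subseteq> Z \<Longrightarrow> Y = Z"
    using finite_has_maximal2[OF assms] by metis
  then show thesis
    by (intro that[of Y]) (auto simp: is_base_def)
qed

lemma min_base_size_le:
  assumes "finite H" "is_base H Y"
  shows "min_base_size H \<le> card Y"
proof -
  have "{card B |B. is_base H B} \<subseteq> card ` H"
    by (auto simp: is_base_def)
  then have "finite {card B |B. is_base H B}"
    using assms(1) finite_subset by blast
  then show ?thesis
    unfolding min_base_size_def using assms(2) by (auto intro: Min_le)
qed

text \<open>Double counting of the pairs \<open>(X, Z)\<close> with \<open>X\<close> in the star of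
  \<open>a\<close>, \<open>Z\<close> outside it and \<open>X - {a} \<subseteq> Z\<close>. Every
  \<open>X\<close> has at least \<open>min_base_size H - r\<close> partners, every \<open>Z\<close>
  at most \<open>r\<close>. If the subtraction truncates, the left side is 0.\<close>

lemma star_le_costar:
  fixes H :: "'a set set"
  assumes finH: "finite H" and fin: "\<And>X. X \<in> H \<Longrightarrow> finite X" and her: "hereditary H"
  shows "(min_base_size H - r) * card {X \<in> level H r. a \<in> X} \<le> r * card {X \<in> level H r. a \<notin> X}"
    (is "?k * card ?S \<le> r * card ?T")
proof -
  have finL: "finite (level H r)"
    using finH by (auto simp: level_def)
  have up: "?k \<le> card {Z \<in> ?T. X - {a} \<subseteq> Z}" if X: "X \<in> ?S" for X
  proof -
    have XH: "X \<in> H" "card X = r" "a \<in> X" "finite X"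
      using X fin by (auto simp: level_def)
    obtain Y where Y: "is_base H Y" "X \<subseteq> Y"
      using ex_base_superset[OF finH XH(1)] .
    have YH: "Y \<in> H" "finite Y"
      using Y fin by (auto simp: is_base_def)
    \<comment> \<open>At most \<open>r\<close> elements of the base \<open>Y\<close> are used up by
      \<open>X\<close>; each of the others can take the place of \<open>a\<close>, and heredity
      keeps the new set in \<open>H\<close>.\<close>
    have "?k \<le> card (Y - X)"
      using min_base_size_le[OF finH Y(1)] XH Y(2) by (simp add: card_Diff_subset)
    also have "\<dots> \<le> card {Z \<in> ?T. X - {a} \<subseteq> Z}"
    proof (rule card_inj_on_le[where f = "\<lambda>y. insert y (X - {a})"])
      show "inj_on (\<lambda>y. insert y (X - {a})) (Y - X)"
        by (rule inj_onI) blast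
      have "insert y (X - {a}) \<in> ?T" if "y \<in> Y - X" for y
      proof -
        have "insert y (X - {a}) \<subseteq> Y"
          using that Y(2) by blast
        then have "insert y (X - {a}) \<in> H"
          using her YH(1) by (auto simp: hereditary_def)
        moreover have "card (insert y (X - {a})) = card X"
          using that XH by (metis DiffD1 DiffD2 card_Suc_Diff1 card_insert_disjoint finite_Diff)
        ultimately show ?thesis
          using that XH by (auto simp: level_def)
      qed
      then show "(\<lambda>y. insert y (X - {a})) ` (Y - X) \<subseteq> {Z \<in> ?T. X - {a} \<subseteq> Z}"
        by blast
      show "finite {Z \<in> ?T. X - {a} \<subseteq> Z}"
        using finL by auto
    qed
    finally show ?thesis .
  qed
  have down: "card {X \<in> ?S. X - {a} \<subseteq> Z} \<le> r" if Z: "Z \<in> ?T" for Z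
  proof -
    have ZH: "finite Z" "card Z = r" "a \<notin> Z"
      using Z fin by (auto simp: level_def)
    have "X \<in> (\<lambda>z. insert a (Z - {z})) ` Z" if X: "X \<in> ?S" "X - {a} \<subseteq> Z" for X
    proof -
      have XH: "card X = r" "a \<in> X" "finite X"
        using X fin by (auto simp: level_def)
      \<comment> \<open>An \<open>(r - 1)\<close>-subset of \<open>Z\<close> misses exactly one
        \<open>z\<close> in \<open>Z\<close>, and this \<open>z\<close> determines \<open>X\<close>;
        hence at most \<open>r\<close> choices of \<open>X\<close>.\<close>
      have "card (Z - (X - {a})) = card Z - card (X - {a})"
        using X(2) XH(3) by (intro card_Diff_subset) auto
      moreover have "card X = Suc (card (X - {a}))"
        using XH by (metis card_Suc_Diff1)
      ultimately have "card (Z - (X - {a})) = 1"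
        using XH(1) ZH(2) by linarith
      then obtain z where z: "Z - (X - {a}) = {z}"
        by (rule card_1_singletonE)
      have "z \<in> Z"
        using z by blast
      moreover have "X = insert a (Z - {z})"
      proof -
        have "X - {a} = Z - {z}"
          using z X(2) by blast
        then show ?thesis
          using XH(2) by blast
      qed
      ultimately show ?thesis
        by blast
    qed
    then have "{X \<in> ?S. X - {a} \<subseteq> Z} \<subseteq> (\<lambda>z. insert a (Z - {z})) ` Z"
      by blast
    then show ?thesis
      using surj_card_le[OF ZH(1)] ZH(2) by blast
  qed
  have "?k * card ?S = (\<Sum>X\<in>?S. ?k)"
    by simp
  also have "\<dots> \<le> (\<Sum>X\<in>?S. card {Z \<in> ?T. X - {a} \<subseteq> Z})"
    by (rule sum_mono) (rule up)
  also have "\<dots> = (\<Sum>X\<in>?S. \<Sum>Z | Z \<in> ?T \<and> X - {a} \<subseteq> Z. 1)"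
    by simp
  also have "\<dots> = (\<Sum>Z\<in>?T. \<Sum>X | X \<in> ?S \<and> X - {a} \<subseteq> Z. 1)"
    by (rule sum.swap_restrict) (use finL in auto)
  also have "\<dots> = (\<Sum>Z\<in>?T. card {X \<in> ?S. X - {a} \<subseteq> Z})"
    by simp
  also have "\<dots> \<le> (\<Sum>Z\<in>?T. r)"
    by (rule sum_mono) (rule down)
  finally show ?thesis
    by (simp add: mult.commute)
qed

text \<open>The hypothesis has the shape of \<open>n_S_r1\<close>: removing \<open>r\<close> leaves
  at least \<open>r * c\<close>, whose factor \<open>r\<close> cancels against the one in
  \<open>star_le_costar\<close>. Adding the star itself to its complement turns \<open>c\<close>
  into \<open>c + 1\<close>.\<close>

lemma card_star_le:
  fixes H :: "'a set set"
  assumes "r \<ge> 1" "finite H" "\<And>X. X \<in> H \<Longrightarrow> finite X" "hereditary H"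
    and "min_base_size H \<ge> r * c + r"
  shows "(c + 1) * card {X \<in> level H r. a \<in> X} \<le> card (level H r)"
proof -
  let ?S = "{X \<in> level H r. a \<in> X}" and ?T = "{X \<in> level H r. a \<notin> X}"
  have "r * (c * card ?S) \<le> (min_base_size H - r) * card ?S"
    unfolding mult.assoc[symmetric] using assms(5) by (intro mult_right_mono) auto
  also have "\<dots> \<le> r * card ?T"
    using assms(2-4) by (rule star_le_costar)
  finally have "c * card ?S \<le> card ?T"
    using assms(1) by simp
  moreover have "card ?S + card ?T = card (level H r)"
    using assms(2) by (subst card_Un_disjoint[symmetric])
      (auto simp: level_def intro: arg_cong[where f = card])
  ultimately show ?thesis
    by simp
qed

text \<open>The stars centred at the elements of \<open>X\<close> cover \<open>F\<close>, so the
  union bound applies. The factor \<open>d\<close> stays on the left to avoid division.\<close>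

lemma card_family_meeting_le:
  assumes fin: "finite L" "finite X" and meet: "\<And>Y. Y \<in> F \<Longrightarrow> Y \<in> L \<and> X \<inter> Y \<noteq> {}"
    and star: "\<And>a. d * card {Y \<in> L. a \<in> Y} \<le> s"
  shows "d * card F \<le> card X * s"
proof -
  have "F \<subseteq> (\<Union>a\<in>X. {Y \<in> L. a \<in> Y})"
    using meet by blast
  then have "card F \<le> card (\<Union>a\<in>X. {Y \<in> L. a \<in> Y})"
    using fin by (intro card_mono) auto
  also have "\<dots> \<le> (\<Sum>a\<in>X. card {Y \<in> L. a \<in> Y})"
    using fin(2) by (rule card_UN_le)
  finally have "d * card F \<le> (\<Sum>a\<in>X. d * card {Y \<in> L. a \<in> Y})"
    by (simp flip: sum_distrib_left)
  also have "\<dots> \<le> (\<Sum>a\<in>X. s)"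
    by (rule sum_mono) (rule star)
  finally show ?thesis
    by simp
qed

text \<open>As \<open>m_r1 r\<close> is at least \<open>2 * r\<close>, the binomial is at least
  \<open>r * (2 * r - 1)\<close>. The summand 1 matters at \<open>r = 1\<close>, where both sides
  equal 2.\<close>

lemma double_le_choose_m_r1:
  assumes "r \<ge> 1"
  shows "2 * r \<le> (m_r1 r choose 2) + 1"
proof -
  obtain q where q: "r = Suc q"
    using assms by (cases r) auto
  have "2 * r \<le> (2 * r choose 2) + 1"
    unfolding q by (simp add: choose_two)
  also have "2 * r choose 2 \<le> m_r1 r choose 2"
    by (rule binomial_right_mono) (simp add: m_r1_def)
  finally show ?thesis
    by simp
qed

theorem theorem2p9:
  fixes r :: nat and H A B :: "'a set set"
  assumes "r \<ge> 1"
    and "finite H" and "\<And>X. X \<in> H \<Longrightarrow> finite X"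
    and "hereditary H"
    and "min_base_size H \<ge> n_S_r1 r"
    and "A \<subseteq> level H r" and "B \<subseteq> level H r"
    and "cross_intersecting A B"
  shows "card A + card B \<le> card (level H r)"
proof (cases "A = {} \<or> B = {}")
  case True
  have "finite (level H r)"
    using assms(2) by (auto simp: level_def)
  then show ?thesis
    using True assms(6,7) by (auto intro: card_mono)
next
  case False
  then obtain X Y where XY: "X \<in> A" "Y \<in> B"
    by blast
  let ?L = "level H r" and ?d = "(m_r1 r choose 2) + 1"
  have finL: "finite ?L"
    using assms(2) by (auto simp: level_def)
  have X: "finite X" "card X = r" and Y: "finite Y" "card Y = r"
    using XY assms(3,6,7) by (auto simp: level_def)
  have star: "?d * card {Z \<in> ?L. a \<in> Z} \<le> card ?L" for a
    using assms(1-5) unfolding n_S_r1_def by (rule card_star_le)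
  \<comment> \<open>The roles cross over: the fixed \<open>X\<close> from \<open>A\<close> bounds
    \<open>B\<close>, and the fixed \<open>Y\<close> from \<open>B\<close> bounds
    \<open>A\<close>.\<close>
  have "?d * card B \<le> card X * card ?L"
    using finL X(1) _ star
    by (rule card_family_meeting_le) (use XY assms(7,8) in \<open>auto simp: cross_intersecting_def\<close>)
  moreover have "?d * card A \<le> card Y * card ?L"
    using finL Y(1) _ star
    by (rule card_family_meeting_le) (use XY assms(6,8) in \<open>auto simp: cross_intersecting_def\<close>)
  \<comment> \<open>The two bounds add up to \<open>2 * r * card ?L\<close>; replacing
    \<open>?d\<close> by the smaller \<open>2 * r\<close> on the left lets this factor
    cancel.\<close>
  moreover have "2 * r * (card A + card B) \<le> ?d * (card A + card B)"
    using double_le_choose_m_r1[OF assms(1)] by (rule mult_right_mono) simp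
  ultimately have "2 * r * (card A + card B) \<le> 2 * r * card ?L"
    unfolding X(2) Y(2) distrib_left by linarith
  then show ?thesis
    using assms(1) by simp
qed

end
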